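(* Let $\epsilon\in(0,1)$ and let $c$ be a real constant such that $p_k:=\frac{1}{e^{c(\log k)^\epsilon}}\in[0,1]$ for all $k\in\mathbb{N}$. Let $X=(X_k)_{k\in\mathbb{N}}$ be a sequence of independent Bernoulli random variables with $$\mathbb{P}[X_k=1]=1-\mathbb{P}[X_k=0]=p_k=\frac{1}{e^{c(\log k)^\epsilon}},\qquad k\in\mathbb{N},$$ and let $\mathcal{E}_X=\{k\in\mathbb{N}:X_k=1\}$. Then almost surely $\mathcal{E}_X$ contains infinitely many arithmetic progressions of arbitrary length; that is, almost surely, for every integer $l\ge 1$, $\mathcal{E}_X$ contains infinitely many arithmetic progressions of length $l$.
   Context: $\mathbb{N}=\{1,2,\dots\}$. An arithmetic progression of length $l$ in $\mathbb{N}$ is a set of the form $\{i,i+d,\dots,i+(l-1)d\}$ with $i,d\in\mathbb{N}$. *)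

theory Defs
  imports "HOL-Probability.Probability"
begin

definition is_AP :: "nat \<Rightarrow> nat set \<Rightarrow> bool" where
  "is_AP l A \<longleftrightarrow> (\<exists>i\<ge>1. \<exists>d\<ge>1. A = {i + j * d | j. j < l})"

text \<open>At \<open>k = 1\<close> we have \<open>ln 1 = 0\<close> and \<open>0 powr \<epsilon> = 0\<close>, so the value is \<open>1\<close>,
  in accordance with \<open>0\<^sup>\<epsilon> = 0\<close> for \<open>\<epsilon> > 0\<close>.\<close>

definition success_prob :: "real \<Rightarrow> real \<Rightarrow> nat \<Rightarrow> real" where
  "success_prob c \<epsilon> k = 1 / exp (c * ln (real k) powr \<epsilon>)"

definition success_set :: "(nat \<Rightarrow> 'a \<Rightarrow> real) \<Rightarrow> 'a \<Rightarrow> nat set" where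
  "success_set X \<omega> = {k. k \<ge> 1 \<and> X k \<omega> = 1}"

end

theory Submission
  imports Defs "HOL-Real_Asymp.Real_Asymp"
begin

text \<open>
  Fix a length \<open>l\<close> and cut \<open>{1, 2, \<dots>}\<close> into the consecutive blocks \<open>{ml + 1, \<dots>, ml + l}\<close>. Each block
  is an arithmetic progression of length \<open>l\<close> with common difference \<open>1\<close>, and since the blocks are
  disjoint, the events that \<open>\<E>\<^sub>X\<close> contains the \<open>m\<close>-th block are independent
  (\<open>indep_events_INT_disjoint\<close>). With \<open>n = (m + 1) l\<close>, such an event has probability at least
  \<open>exp (- l \<bar>c\<bar> (ln n)\<^sup>\<epsilon>)\<close>, and because \<open>\<epsilon> < 1\<close> this is eventually at least \<open>1 / n\<close>. Hence the
  probabilities have a divergent sum (\<open>not_summable_block_prob\<close>), and the second Borel--Cantelli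
  lemma (\<open>borel_cantelli_AE2\<close>) shows that almost surely infinitely many blocks lie in \<open>\<E>\<^sub>X\<close>.
\<close>

lemma (in prob_space) indep_events_INT_disjoint:
  assumes ind: "indep_events A I"
    and B: "\<And>j. j \<in> L \<Longrightarrow> B j \<subseteq> I" "\<And>j. j \<in> L \<Longrightarrow> finite (B j)" "\<And>j. j \<in> L \<Longrightarrow> B j \<noteq> {}"
    and disj: "disjoint_family_on B L"
  shows "indep_events (\<lambda>j. \<Inter>i\<in>B j. A i) L"
  unfolding indep_events_def
proof (intro conjI allI impI)
  have prob_INT: "prob (\<Inter>i\<in>K. A i) = (\<Prod>i\<in>K. prob (A i))"
    if "K \<subseteq> I" "K \<noteq> {}" "finite K" for K
    using ind that unfolding indep_events_def by blast
  have "A i \<in> events" if "i \<in> I" for i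
    using ind that unfolding indep_events_def by blast
  then show "(\<lambda>j. \<Inter>i\<in>B j. A i) ` L \<subseteq> events"
    using B by (auto intro!: sets.finite_INT)
  fix J assume J: "J \<subseteq> L" "J \<noteq> {}" "finite J"
  have "prob (\<Inter>j\<in>J. \<Inter>i\<in>B j. A i) = prob (\<Inter>i\<in>(\<Union>j\<in>J. B j). A i)"
    by (rule arg_cong[where f = prob]) auto
  also have "\<dots> = (\<Prod>i\<in>(\<Union>j\<in>J. B j). prob (A i))"
  proof (rule prob_INT)
    show "(\<Union>j\<in>J. B j) \<subseteq> I"
      using J(1) B(1) by fast
    show "(\<Union>j\<in>J. B j) \<noteq> {}"
      using J(1,2) B(3) by fastforce
    show "finite (\<Union>j\<in>J. B j)"
      using J(1,3) B(2) by auto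
  qed
  also have "\<dots> = (\<Prod>j\<in>J. \<Prod>i\<in>B j. prob (A i))"
  proof (rule prod.UNION_disjoint)
    show "finite J"
      by fact
    show "\<forall>j\<in>J. finite (B j)"
      using J(1) B(2) by auto
    show "\<forall>i\<in>J. \<forall>j\<in>J. i \<noteq> j \<longrightarrow> B i \<inter> B j = {}"
      using J(1) disj unfolding disjoint_family_on_def by blast
  qed
  also have "\<dots> = (\<Prod>j\<in>J. prob (\<Inter>i\<in>B j. A i))"
  proof (rule prod.cong[OF refl])
    fix j assume "j \<in> J"
    then have "j \<in> L"
      using J(1) by auto
    then show "(\<Prod>i\<in>B j. prob (A i)) = prob (\<Inter>i\<in>B j. A i)"
      by (intro prob_INT[symmetric] B)
  qed
  finally show "prob (\<Inter>j\<in>J. \<Inter>i\<in>B j. A i) = (\<Prod>j\<in>J. prob (\<Inter>i\<in>B j. A i))" .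
qed

lemma (in prob_space) indep_events_prob_INT_compl:
  assumes ind: "indep_events E I" and J: "J \<subseteq> I" "J \<noteq> {}" "finite J"
  shows "prob (\<Inter>j\<in>J. space M - E j) = (\<Prod>j\<in>J. 1 - prob (E j))"
proof -
  have E: "E j \<in> events" if "j \<in> I" for j
    using ind that unfolding indep_events_def by blast
  have "indep_sets (\<lambda>i. sigma_sets (space M) {E i}) I"
    using ind unfolding indep_events_def_alt by (intro indep_sets_sigma) (auto simp: Int_stable_def)
  moreover have "space M - E j \<in> sigma_sets (space M) {E j}" for j
    by (intro sigma_sets.Compl sigma_sets.Basic) simp
  ultimately have "prob (\<Inter>j\<in>J. space M - E j) = (\<Prod>j\<in>J. prob (space M - E j))"
    using J by (intro indep_setsD) auto
  also have "\<dots> = (\<Prod>j\<in>J. 1 - prob (E j))"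
    using J E by (intro prod.cong refl prob_compl) auto
  finally show ?thesis .
qed

text \<open>The second Borel--Cantelli lemma: by \<open>1 - x \<le> exp (- x)\<close>, the probability that none of
  \<open>E\<^sub>n, \<dots>, E\<^sub>n\<^sub>+\<^sub>k\<close> occurs is at most \<open>exp (- (prob E\<^sub>n + \<dots> + prob E\<^sub>n\<^sub>+\<^sub>k))\<close>.\<close>

lemma (in prob_space) borel_cantelli_AE2:
  fixes E :: "nat \<Rightarrow> 'a set"
  assumes ind: "indep_events E UNIV" and div: "\<not> summable (\<lambda>n. prob (E n))"
  shows "AE x in M. infinite {n. x \<in> E n}"
proof -
  have E[measurable]: "E n \<in> events" for n
    using ind unfolding indep_events_def by blast
  \<comment> \<open>A positive probability \<open>q\<close> that no \<open>E j\<close> with \<open>j \<ge> n\<close> occurs would bound the partial sums.\<close>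
  have null: "prob (\<Inter>j\<in>{n..}. space M - E j) = 0" for n
  proof (rule ccontr)
    define q where "q = prob (\<Inter>j\<in>{n..}. space M - E j)"
    assume "prob (\<Inter>j\<in>{n..}. space M - E j) \<noteq> 0"
    then have "q > 0"
      unfolding q_def by (simp add: zero_less_measure_iff)
    have bound: "(\<Sum>j<k. prob (E (j + n))) \<le> - ln q" for k
    proof -
      have "q \<le> prob (\<Inter>j\<in>{n..n + k}. space M - E j)"
        unfolding q_def by (intro finite_measure_mono sets.finite_INT) auto
      also have "\<dots> = (\<Prod>j\<in>{n..n + k}. 1 - prob (E j))"
        by (intro indep_events_prob_INT_compl[OF ind]) auto
      also have "\<dots> \<le> (\<Prod>j\<in>{n..n + k}. exp (- prob (E j)))"
        using exp_ge_add_one_self[of "- prob (E j)" for j] by (intro prod_mono) auto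
      also have "\<dots> = exp (- (\<Sum>j\<in>{n..n + k}. prob (E j)))"
        by (simp add: exp_sum sum_negf[symmetric])
      finally have "ln q \<le> - (\<Sum>j\<in>{n..n + k}. prob (E j))"
        using \<open>q > 0\<close> by (metis ln_exp ln_le_cancel_iff exp_gt_zero)
      moreover have "(\<Sum>j<k. prob (E (j + n))) = (\<Sum>j\<in>{n..<n + k}. prob (E j))"
        using sum.shift_bounds_nat_ivl[of "\<lambda>j. prob (E j)" 0 n k]
        by (simp add: atLeast0LessThan add.commute)
      moreover have "\<dots> \<le> (\<Sum>j\<in>{n..n + k}. prob (E j))"
        by (intro sum_mono2) auto
      ultimately show ?thesis by linarith
    qed
    have "summable (\<lambda>j. prob (E (j + n)))"
      using bound by (intro summableI_nonneg_bounded[where x = "- ln q"]) auto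
    then show False
      using div summable_iff_shift[of "\<lambda>j. prob (E j)" n] by blast
  qed
  have "AE x in M. x \<notin> (\<Inter>j\<in>{n..}. space M - E j)" for n
    using null[of n] by (intro AE_not_in) (auto simp: null_sets_def emeasure_eq_measure)
  then have "AE x in M. \<forall>n. x \<notin> (\<Inter>j\<in>{n..}. space M - E j)"
    by (simp add: AE_all_countable)
  then show ?thesis
    by (rule AE_mp) (auto intro!: AE_I2 simp: infinite_nat_iff_unbounded_le)
qed

lemma success_prob_lower_bound:
  assumes "0 \<le> \<epsilon>" and "1 \<le> k" and "k \<le> n"
  shows "exp (- (\<bar>c\<bar> * ln (real n) powr \<epsilon>)) \<le> success_prob c \<epsilon> k"
proof -
  have "c * ln (real k) powr \<epsilon> \<le> \<bar>c\<bar> * ln (real k) powr \<epsilon>"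
    by (intro mult_right_mono) auto
  also have "\<dots> \<le> \<bar>c\<bar> * ln (real n) powr \<epsilon>"
    using assms by (intro mult_left_mono powr_mono2) auto
  finally show ?thesis
    by (simp add: success_prob_def exp_minus inverse_eq_divide field_simps)
qed

text \<open>With \<open>n = (m + 1) l\<close> the largest element of the block, each of its \<open>l\<close> factors is at least
  \<open>exp (- \<bar>c\<bar> (ln n)\<^sup>\<epsilon>)\<close>, so that the product is eventually at least \<open>1 / n\<close>; the harmonic series diverges.\<close>

lemma not_summable_block_prob:
  fixes c \<epsilon> :: real
  assumes \<epsilon>: "0 < \<epsilon>" "\<epsilon> < 1" and l: "1 \<le> l"
  shows "\<not> summable (\<lambda>m. \<Prod>k\<in>{m * l<..m * l + l}. success_prob c \<epsilon> k)"
proof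
  assume summable: "summable (\<lambda>m. \<Prod>k\<in>{m * l<..m * l + l}. success_prob c \<epsilon> k)"
  \<comment> \<open>The summand \<open>1\<close> only serves to make \<open>a\<close> positive when \<open>c = 0\<close>.\<close>
  define a where "a = real l * \<bar>c\<bar> + 1"
  have "a > 0" by (simp add: a_def add_nonneg_pos)
  have "eventually (\<lambda>x::real. a * ln x powr \<epsilon> \<le> ln x) at_top"
    using \<epsilon> \<open>a > 0\<close> by real_asymp
  moreover have "filterlim (\<lambda>m. real (m * l + l)) at_top sequentially"
    using l by real_asymp
  ultimately have "\<forall>\<^sub>F m in sequentially. a * ln (real (m * l + l)) powr \<epsilon> \<le> ln (real (m * l + l))"
    by (rule eventually_compose_filterlim)
  then have "\<forall>\<^sub>F m in sequentially.
      norm (1 / real (m * l + l)) \<le> (\<Prod>k\<in>{m * l<..m * l + l}. success_prob c \<epsilon> k)"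
  proof eventually_elim
    case (elim m)
    let ?n = "m * l + l"
    have "real l * \<bar>c\<bar> * ln (real ?n) powr \<epsilon> \<le> a * ln (real ?n) powr \<epsilon>"
      unfolding a_def by (intro mult_right_mono) auto
    with elim have le: "real l * \<bar>c\<bar> * ln (real ?n) powr \<epsilon> \<le> ln (real ?n)"
      by linarith
    have "0 < real ?n"
      using l by (simp only: of_nat_0_less_iff)
    then have "norm (1 / real ?n) = exp (- ln (real ?n))"
      by (simp only: exp_minus exp_ln inverse_eq_divide real_norm_def abs_of_pos divide_pos_pos
          zero_less_one)
    also have "\<dots> \<le> exp (- (real l * \<bar>c\<bar> * ln (real ?n) powr \<epsilon>))"
      using le by simp
    also have "\<dots> = (\<Prod>k\<in>{m * l<..m * l + l}. exp (- (\<bar>c\<bar> * ln (real ?n) powr \<epsilon>)))"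
      by (simp add: exp_of_nat_mult[symmetric] mult.assoc del: exp_of_nat_mult)
    also have "\<dots> \<le> (\<Prod>k\<in>{m * l<..m * l + l}. success_prob c \<epsilon> k)"
      using \<epsilon> by (intro prod_mono conjI success_prob_lower_bound) auto
    finally show ?case .
  qed
  then have "summable (\<lambda>m. 1 / real (m * l + l))"
    using summable by (rule summable_comparison_test_ev)
  then have "summable (\<lambda>m. real l * (1 / real (m * l + l)))"
    by (rule summable_mult)
  also have "(\<lambda>m. real l * (1 / real (m * l + l))) = (\<lambda>m. inverse (real (Suc m)))"
  proof
    fix m
    have "real (m * l + l) = real l * real (Suc m)"
      by (simp add: algebra_simps)
    then show "real l * (1 / real (m * l + l)) = inverse (real (Suc m))"
      using l by (simp add: inverse_eq_divide del: of_nat_Suc)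
  qed
  finally show False
    using not_summable_harmonic[where 'a = real] summable_Suc_iff[of "\<lambda>n. inverse (real n)"]
    by blast
qed

lemma is_AP_block:
  assumes "1 \<le> l"
  shows "is_AP l {m * l<..m * l + l}"
proof -
  have "x \<in> {m * l + 1 + j * 1 | j. j < l}" if "x \<in> {m * l<..m * l + l}" for x
    using that by (auto intro!: exI[of _ "x - (m * l + 1)"])
  then have "{m * l<..m * l + l} = {m * l + 1 + j * 1 | j. j < l}"
    by auto
  then show ?thesis
    unfolding is_AP_def by (intro exI[of _ "m * l + 1"] exI[of _ 1] conjI) auto
qed

lemma disjoint_family_blocks: "disjoint_family (\<lambda>m::nat. {m * l<..m * l + l})"
proof -
  have "{m * l<..m * l + l} \<inter> {n * l<..n * l + l} = {}" if "m < n" for m n :: nat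
    using mult_le_mono1[of "Suc m" n l] that by auto
  then show ?thesis
    unfolding disjoint_family_on_def by (metis Int_commute linorder_neqE_nat)
qed

theorem proposition1p5:
  fixes M :: "'a measure" and X :: "nat \<Rightarrow> 'a \<Rightarrow> real" and c \<epsilon> :: real
  assumes "prob_space M"
    and "0 < \<epsilon>" and "\<epsilon> < 1"
    and "\<And>k. k \<ge> 1 \<Longrightarrow> success_prob c \<epsilon> k \<in> {0..1}"
    and "prob_space.indep_vars M (\<lambda>_. borel) X {1..}"
    and "\<And>k. k \<ge> 1 \<Longrightarrow> \<P>(\<omega> in M. X k \<omega> = 1) = success_prob c \<epsilon> k"
    and "\<And>k. k \<ge> 1 \<Longrightarrow> 1 - \<P>(\<omega> in M. X k \<omega> = 0) = success_prob c \<epsilon> k"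
  shows "AE \<omega> in M. \<forall>l\<ge>1. infinite {A. is_AP l A \<and> A \<subseteq> success_set X \<omega>}"
proof -
  interpret prob_space M by fact
  have ind: "indep_events (\<lambda>k. {\<omega> \<in> space M. X k \<omega> = 1}) {1..}"
  proof -
    have eq: "{\<omega> \<in> space M. X k \<omega> = 1} = X k -` {1} \<inter> space M" for k
      by auto
    have "(\<lambda>k. X k -` {1} \<inter> space M) ` {1..} \<subseteq> events"
      using assms(5) unfolding indep_vars_def by (auto intro: measurable_sets)
    moreover have "prob (\<Inter>k\<in>K. X k -` {1} \<inter> space M) = (\<Prod>k\<in>K. prob (X k -` {1} \<inter> space M))"
      if "K \<subseteq> {1..}" "K \<noteq> {}" "finite K" for K
      using that by (intro indep_varsD[OF assms(5)]) auto
    ultimately show ?thesis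
      unfolding indep_events_def eq by blast
  qed
  have "AE \<omega> in M. infinite {A. is_AP l A \<and> A \<subseteq> success_set X \<omega>}" if l: "1 \<le> l" for l
  proof -
    define B where "B m = {m * l<..m * l + l}" for m :: nat
    define E where "E m = (\<Inter>k\<in>B m. {\<omega> \<in> space M. X k \<omega> = 1})" for m
    have B: "B m \<subseteq> {1..}" "finite (B m)" "B m \<noteq> {}" for m
      using l by (auto simp: B_def)
    have disj: "disjoint_family B"
      unfolding B_def by (rule disjoint_family_blocks)
    have "prob (E m) = (\<Prod>k\<in>B m. success_prob c \<epsilon> k)" for m
    proof -
      have "prob (E m) = (\<Prod>k\<in>B m. \<P>(\<omega> in M. X k \<omega> = 1))"
        unfolding E_def using ind B[of m] unfolding indep_events_def by blast
      also have "\<dots> = (\<Prod>k\<in>B m. success_prob c \<epsilon> k)"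
        using B(1)[of m] assms(6) by (intro prod.cong) auto
      finally show ?thesis .
    qed
    then have "\<not> summable (\<lambda>m. prob (E m))"
      using not_summable_block_prob[OF assms(2,3) l] by (simp add: B_def)
    moreover have "indep_events E UNIV"
      unfolding E_def using B disj by (intro indep_events_INT_disjoint[OF ind]) auto
    ultimately have "AE \<omega> in M. infinite {m. \<omega> \<in> E m}"
      by (intro borel_cantelli_AE2)
    then show ?thesis
    proof (rule AE_mp, intro AE_I2 impI)
      fix \<omega> assume inf: "infinite {m. \<omega> \<in> E m}"
      have "inj B"
        using disj B(3) by (intro injI) (metis disjoint_family_onD UNIV_I Int_absorb)
      then have "infinite (B ` {m. \<omega> \<in> E m})"
        using inf by (metis finite_imageD inj_on_subset subset_UNIV)
      moreover have "B ` {m. \<omega> \<in> E m} \<subseteq> {A. is_AP l A \<and> A \<subseteq> success_set X \<omega>}"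
        using B(1) is_AP_block[OF l] by (fastforce simp: E_def B_def success_set_def)
      ultimately show "infinite {A. is_AP l A \<and> A \<subseteq> success_set X \<omega>}"
        by (rule infinite_super[rotated])
    qed
  qed
  then show ?thesis
    by (auto simp: AE_all_countable)
qed

end
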